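(* There exists a Borel probability measure $\mu$ on the set of oriented paths from the origin in $\mathbf{Z}^3$ that has exponential intersection tails; that is, there exist $\theta\in(0,1)$ and $C<\infty$ such that for all $n$, $$\mu\times\mu\{(\varphi,\psi): |\varphi\cap\psi|\ge n\}\le C\theta^n .$$
   Context: An oriented path from the origin in $\mathbf{Z}^d$ is an infinite path with vertices $\{y_n\}_{n\ge0}$, where $y_0=0$ and for each $n\ge1$ the increment $y_n-y_{n-1}$ is one of the $d$ standard basis vectors. The set of such paths carries the Borel structure of the product topology. For two paths $\varphi,\psi$, $|\varphi\cap\psi|$ denotes the number of edges in the intersection of $\varphi$ and $\psi$. *)

theory Defs
  imports "HOL-Probability.Probability" "HOL-Library.Extended_Nat"
begin

text \<open>The lattice $\mathbf{Z}^d$ is \<^typ>\<open>int ^ 'd\<close>. Its topology (a finite product of the discrete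
  topology on the integers) is discrete, and the topology on \<^typ>\<open>nat \<Rightarrow> int ^ 'd\<close> is the
  product topology.\<close>

definition oriented_paths :: "(nat \<Rightarrow> int ^ 'd) set" where
  "oriented_paths = {y. y 0 = 0 \<and> (\<forall>n\<ge>1. \<exists>i. y n - y (n - 1) = axis i 1)}"

definition path_borel :: "(nat \<Rightarrow> int ^ 'd) measure" where
  "path_borel = restrict_space borel oriented_paths"

definition path_edges :: "(nat \<Rightarrow> int ^ 'd) \<Rightarrow> (int ^ 'd) set set" where
  "path_edges y = range (\<lambda>n. {y n, y (Suc n)})"

text \<open>Two paths may share infinitely many edges, so the number of common edges is an extended
  natural number; \<^const>\<open>card\<close> alone would assign the value 0 in that case.\<close>

definition num_common_edges :: "(nat \<Rightarrow> int ^ 'd) \<Rightarrow> (nat \<Rightarrow> int ^ 'd) \<Rightarrow> enat" where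
  "num_common_edges \<phi> \<psi> =
     (if finite (path_edges \<phi> \<inter> path_edges \<psi>)
      then enat (card (path_edges \<phi> \<inter> path_edges \<psi>)) else \<infinity>)"

definition exponential_intersection_tails :: "(nat \<Rightarrow> int ^ 'd) measure \<Rightarrow> bool" where
  "exponential_intersection_tails \<mu> \<longleftrightarrow>
     (\<exists>\<theta> C :: real. 0 < \<theta> \<and> \<theta> < 1 \<and>
        (\<forall>n::nat. measure (\<mu> \<Otimes>\<^sub>M \<mu>)
            {(\<phi>, \<psi>) \<in> space (\<mu> \<Otimes>\<^sub>M \<mu>). num_common_edges \<phi> \<psi> \<ge> enat n} \<le> C * \<theta> ^ n))"

text \<open>The events above are measurable, so that \<^const>\<open>measure\<close> does not take its default value 0
  on them.\<close>

lemma le_num_common_edges_iff: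
  "enat n \<le> num_common_edges \<phi> \<psi> \<longleftrightarrow>
     (\<exists>F. finite F \<and> card F = n \<and> F \<subseteq> path_edges \<phi> \<and> F \<subseteq> path_edges \<psi>)"
proof (cases "finite (path_edges \<phi> \<inter> path_edges \<psi>)")
  case True
  show ?thesis
  proof
    assume "enat n \<le> num_common_edges \<phi> \<psi>"
    then have "n \<le> card (path_edges \<phi> \<inter> path_edges \<psi>)"
      using True by (simp add: num_common_edges_def)
    then obtain F where "F \<subseteq> path_edges \<phi> \<inter> path_edges \<psi>" "card F = n" "finite F"
      using obtain_subset_with_card_n by metis
    then show "\<exists>F. finite F \<and> card F = n \<and> F \<subseteq> path_edges \<phi> \<and> F \<subseteq> path_edges \<psi>" by auto
  next
    assume "\<exists>F. finite F \<and> card F = n \<and> F \<subseteq> path_edges \<phi> \<and> F \<subseteq> path_edges \<psi>"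
    then show "enat n \<le> num_common_edges \<phi> \<psi>"
      using True card_mono[OF True] by (auto simp: num_common_edges_def)
  qed
next
  case False
  then obtain F where "F \<subseteq> path_edges \<phi> \<inter> path_edges \<psi>" "card F = n" "finite F"
    using infinite_arbitrarily_large by metis
  with False show ?thesis by (auto simp: num_common_edges_def)
qed

lemma sets_vertex_eq:
  fixes a :: "int ^ 'd"
  shows "{y :: nat \<Rightarrow> int ^ 'd. y n = a} \<in> sets borel"
proof -
  have "(\<lambda>y::nat \<Rightarrow> int ^ 'd. y n) -` {a} \<inter> space borel \<in> sets borel"
  proof (rule measurable_sets)
    show "(\<lambda>y::nat \<Rightarrow> int ^ 'd. y n) \<in> borel_measurable borel"
      by (intro borel_measurable_continuous_onI continuous_on_product_coordinates)
    have "closed {a}"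
    proof -
      have "{a} = (\<Inter>i. (\<lambda>x. x $ i) -` {a $ i})" by (auto simp: vec_eq_iff)
      moreover have "closed \<dots>"
        by (intro closed_INT ballI closed_vimage_vec_nth) (auto simp: closed_def open_discrete)
      ultimately show ?thesis by simp
    qed
    then show "{a} \<in> sets borel" by simp
  qed
  then show ?thesis by (simp add: vimage_def)
qed

lemma sets_mem_path_edges:
  fixes e :: "(int ^ 'd) set"
  shows "{y. e \<in> path_edges y} \<in> sets borel"
proof -
  have "{y. e \<in> path_edges y} =
      (\<Union>n. \<Union>p\<in>{(a, b). {a, b} = e}. {y. y n = fst p} \<inter> {y. y (Suc n) = snd p})"
    by (auto simp: path_edges_def)
  also have "\<dots> \<in> sets borel"
    by (intro sets.countable_UN'' sets.Int sets_vertex_eq) auto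
  finally show ?thesis .
qed

lemma sets_num_common_edges_ge:
  fixes \<mu> :: "(nat \<Rightarrow> int ^ 'd) measure"
  assumes "sets \<mu> = sets path_borel"
  shows "{(\<phi>, \<psi>) \<in> space (\<mu> \<Otimes>\<^sub>M \<mu>). num_common_edges \<phi> \<psi> \<ge> enat n} \<in> sets (\<mu> \<Otimes>\<^sub>M \<mu>)"
proof -
  have sp: "space \<mu> = oriented_paths"
    using sets_eq_imp_space_eq[OF assms] by (simp add: path_borel_def space_restrict_space)
  define A where "A F = {y \<in> space \<mu>. F \<subseteq> path_edges y}" for F
  define \<F> where "\<F> = {F. finite F \<and> F \<subseteq> {E :: (int ^ 'd) set. finite E \<and> E \<subseteq> UNIV} \<and> card F = n}"
  have fin: "finite e" if "e \<in> path_edges y" for e and y :: "nat \<Rightarrow> int ^ 'd"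
    using that by (auto simp: path_edges_def)
  have A: "A F \<in> sets \<mu>" if "finite F" for F
  proof -
    have "(\<Inter>e\<in>F. {y. e \<in> path_edges y}) \<in> sets borel"
      using that
    proof (cases "F = {}")
      case False
      then show ?thesis using that by (intro sets.finite_INT sets_mem_path_edges) auto
    qed simp
    moreover have "A F = (\<Inter>e\<in>F. {y. e \<in> path_edges y}) \<inter> oriented_paths"
      by (auto simp: A_def sp)
    ultimately show ?thesis
      by (auto simp: assms path_borel_def sets_restrict_space)
  qed
  have "countable {F. finite F \<and> F \<subseteq> {E :: (int ^ 'd) set. finite E \<and> E \<subseteq> UNIV}}"
    by (intro countable_Collect_finite_subset) auto
  then have "countable \<F>" by (rule countable_subset[rotated]) (auto simp: \<F>_def)
  have "{(\<phi>, \<psi>) \<in> space (\<mu> \<Otimes>\<^sub>M \<mu>). num_common_edges \<phi> \<psi> \<ge> enat n} = (\<Union>F\<in>\<F>. A F \<times> A F)"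
  proof (intro set_eqI iffI)
    fix x
    assume "x \<in> {(\<phi>, \<psi>) \<in> space (\<mu> \<Otimes>\<^sub>M \<mu>). num_common_edges \<phi> \<psi> \<ge> enat n}"
    then obtain \<phi> \<psi> F where x: "x = (\<phi>, \<psi>)" "\<phi> \<in> space \<mu>" "\<psi> \<in> space \<mu>"
      and F: "finite F" "card F = n" "F \<subseteq> path_edges \<phi>" "F \<subseteq> path_edges \<psi>"
      by (auto simp: le_num_common_edges_iff space_pair_measure)
    have "F \<in> \<F>" using F fin by (auto simp: \<F>_def)
    with x F show "x \<in> (\<Union>F\<in>\<F>. A F \<times> A F)" by (auto simp: A_def)
  next
    fix x
    assume "x \<in> (\<Union>F\<in>\<F>. A F \<times> A F)"
    then show "x \<in> {(\<phi>, \<psi>) \<in> space (\<mu> \<Otimes>\<^sub>M \<mu>). num_common_edges \<phi> \<psi> \<ge> enat n}"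
      by (auto simp: le_num_common_edges_iff space_pair_measure A_def \<F>_def)
  qed
  also have "\<dots> \<in> sets (\<mu> \<Otimes>\<^sub>M \<mu>)"
    using \<open>countable \<F>\<close> A by (intro sets.countable_UN'' pair_measureI) (auto simp: \<F>_def)
  finally show ?thesis .
qed

end

theory Submission
  imports Defs
begin

text \<open>Let a $0$/$1$-valued step sequence follow a random slope which is perturbed independently on every
  dyadic block $[i2^j,(i+1)2^j)$, by an amount uniform on $[0,a_j]$ with $\sum_j a_j\le 1$.
  Any time interval of length $k$ contains a whole dyadic block of length comparable to $k$; conditionally
  on everything but the perturbation and the coin flips of that block, the sum of its steps is a
  Poisson binomial variable whose parameters are shifted by a common uniform variable, and such a
  variable takes each value with probability at most $2/(a_j2^j)$. With $a_j=(3/4)^j/3$ the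
  position of the walk $k$ steps ahead is predictable with probability at most of order $k^{-\alpha}$,
  $\alpha=\log_2(3/2)>1/2$, whatever the past.

  Two independent such walks decide, in turn, between the first and second and between the first
  and third basis vector. The squared bounds are summable, so their sum over $k\ge M$ is at most
  $1/2$ for some $M$. If the path meets a given path more than $mM$ times then it does so along $m$
  times with gaps at least $M$, and a union bound over the gaps gives probability at most $2^{-m}$.\<close>

section \<open>Poisson binomial distributions with a common random shift\<close>

fun poisson_binomial :: "(nat \<Rightarrow> real) \<Rightarrow> nat \<Rightarrow> int \<Rightarrow> real" where
  "poisson_binomial p 0 x = (if x = 0 then 1 else 0)"
| "poisson_binomial p (Suc n) x =
     p n * poisson_binomial p n (x - 1) + (1 - p n) * poisson_binomial p n x"

fun poisson_binomial_tail :: "(nat \<Rightarrow> real) \<Rightarrow> nat \<Rightarrow> int \<Rightarrow> real" where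
  "poisson_binomial_tail p 0 x = (if x \<le> 0 then 1 else 0)"
| "poisson_binomial_tail p (Suc n) x =
     p n * poisson_binomial_tail p n (x - 1) + (1 - p n) * poisson_binomial_tail p n x"

text \<open>The derivative of the tail when all success probabilities grow at unit speed.\<close>

fun poisson_binomial_tail_deriv :: "(nat \<Rightarrow> real) \<Rightarrow> nat \<Rightarrow> int \<Rightarrow> real" where
  "poisson_binomial_tail_deriv p 0 x = 0"
| "poisson_binomial_tail_deriv p (Suc n) x = poisson_binomial p n (x - 1)
     + p n * poisson_binomial_tail_deriv p n (x - 1)
     + (1 - p n) * poisson_binomial_tail_deriv p n x"

lemma poisson_binomial_nonneg:
  "(\<And>k. k < n \<Longrightarrow> 0 \<le> p k \<and> p k \<le> 1) \<Longrightarrow> 0 \<le> poisson_binomial p n x"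
  by (induction n arbitrary: x) simp_all

lemma poisson_binomial_cong:
  "(\<And>k. k < n \<Longrightarrow> p k = p' k) \<Longrightarrow> poisson_binomial p n x = poisson_binomial p' n x"
  by (induction n arbitrary: x) simp_all

lemma poisson_binomial_tail_bounds:
  "(\<And>k. k < n \<Longrightarrow> 0 \<le> p k \<and> p k \<le> 1) \<Longrightarrow>
     0 \<le> poisson_binomial_tail p n x \<and> poisson_binomial_tail p n x \<le> 1"
proof (induction n arbitrary: x)
  case (Suc n)
  then have b: "0 \<le> poisson_binomial_tail p n y \<and> poisson_binomial_tail p n y \<le> 1" for y
    by simp
  have p: "0 \<le> p n" "p n \<le> 1" using Suc.prems by auto
  then show ?case
    using b convex_bound_le[of "poisson_binomial_tail p n (x - 1)" 1
        "poisson_binomial_tail p n x" "p n" "1 - p n"]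
    by simp
qed simp

lemma poisson_binomial_eq_tail_diff:
  "poisson_binomial p n x = poisson_binomial_tail p n x - poisson_binomial_tail p n (x + 1)"
proof (induction n arbitrary: x)
  case (Suc n)
  show ?case by (simp add: Suc.IH) (simp add: algebra_simps)
qed auto

text \<open>The product rule in the last parameter yields a difference of two adjacent tails, which
  is the point mass in the recursion.\<close>

lemma DERIV_poisson_binomial_tail:
  "((\<lambda>u. poisson_binomial_tail (\<lambda>k. q k + a * u) n x) has_real_derivative
     a * poisson_binomial_tail_deriv (\<lambda>k. q k + a * u) n x) (at u)"
proof (induction n arbitrary: x)
  case (Suc n)
  show ?case
    unfolding poisson_binomial_tail.simps poisson_binomial_tail_deriv.simps
    by (rule derivative_eq_intros Suc refl)+
      (simp add: poisson_binomial_eq_tail_diff algebra_simps)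
qed simp

text \<open>Raising the k-th parameter raises P(S >= x) at rate P(S_k = x - 1), where S_k omits
  trial k, and the derivative sums these rates. On the event S = x there are x successes and n - x
  failures; counting the former gives the first bound, counting the latter the second. In the sum of
  the two bounds the factor x cancels.\<close>

lemma poisson_binomial_tail_deriv_ge:
  assumes "\<And>k. k < n \<Longrightarrow> 0 \<le> p k \<and> p k \<le> 1"
  shows "x * poisson_binomial p n x \<le> poisson_binomial_tail_deriv p n x"
    and "(real n - x) * poisson_binomial p n x \<le> poisson_binomial_tail_deriv p n (x + 1)"
proof -
  show "x * poisson_binomial p n x \<le> poisson_binomial_tail_deriv p n x"
    using assms
  proof (induction n arbitrary: x)
    case (Suc n)
    have p: "0 \<le> p n" "p n \<le> 1" using Suc.prems by auto
    have nn: "0 \<le> poisson_binomial p n (x - 1)"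
      using Suc.prems by (intro poisson_binomial_nonneg) auto
    have IH: "real_of_int y * poisson_binomial p n y \<le> poisson_binomial_tail_deriv p n y" for y
      using Suc by simp
    have "0 \<le> (1 - p n) * poisson_binomial p n (x - 1)"
      using p nn by simp
    moreover have "p n * ((x - 1) * poisson_binomial p n (x - 1))
        \<le> p n * poisson_binomial_tail_deriv p n (x - 1)"
      using IH[of "x - 1"] p by (intro mult_left_mono) auto
    moreover have "(1 - p n) * (x * poisson_binomial p n x)
        \<le> (1 - p n) * poisson_binomial_tail_deriv p n x"
      using IH[of x] p by (intro mult_left_mono) auto
    ultimately show ?case by (simp add: algebra_simps)
  qed simp
  show "(real n - x) * poisson_binomial p n x \<le> poisson_binomial_tail_deriv p n (x + 1)"
    using assms
  proof (induction n arbitrary: x)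
    case (Suc n)
    have p: "0 \<le> p n" "p n \<le> 1" using Suc.prems by auto
    have nn: "0 \<le> poisson_binomial p n x"
      using Suc.prems by (intro poisson_binomial_nonneg) auto
    have IH: "(real n - real_of_int y) * poisson_binomial p n y
        \<le> poisson_binomial_tail_deriv p n (y + 1)" for y
      using Suc by simp
    have "0 \<le> p n * poisson_binomial p n x"
      using p nn by simp
    moreover have "p n * ((real n - (x - 1)) * poisson_binomial p n (x - 1))
        \<le> p n * poisson_binomial_tail_deriv p n x"
      using IH[of "x - 1"] p by (intro mult_left_mono) auto
    moreover have "(1 - p n) * ((real n - x) * poisson_binomial p n x)
        \<le> (1 - p n) * poisson_binomial_tail_deriv p n (x + 1)"
      using IH[of x] p by (intro mult_left_mono) auto
    ultimately show ?case by (simp add: algebra_simps)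
  qed simp
qed

lemma borel_measurable_poisson_binomial [measurable]:
  assumes [measurable]: "\<And>k. (\<lambda>w. p w k) \<in> borel_measurable M" "x \<in> measurable M (count_space UNIV)"
  shows "(\<lambda>w. poisson_binomial (p w) n (x w)) \<in> borel_measurable M"
  using assms(2)
proof (induction n arbitrary: x)
  case 0
  note [measurable] = 0
  show ?case by simp
next
  case (Suc n)
  note [measurable] = Suc.prems
  have [measurable]: "(\<lambda>w. poisson_binomial (p w) n (x w - 1)) \<in> borel_measurable M"
    by (rule Suc.IH) simp
  have [measurable]: "(\<lambda>w. poisson_binomial (p w) n (x w)) \<in> borel_measurable M"
    by (rule Suc.IH) simp
  show ?case by simp
qed

text \<open>The smoothing works because $n\,P(S=x)$ is at most the derivative of $P(S\ge x)+P(S\ge x+1)$,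
  which is integrated over the common shift of the parameters.\<close>

lemma poisson_binomial_smoothing:
  fixes a :: real and q :: "nat \<Rightarrow> real"
  assumes q: "\<And>k u. k < n \<Longrightarrow> u \<in> {0..1} \<Longrightarrow> 0 \<le> q k + a * u \<and> q k + a * u \<le> 1"
    and "0 < a" "0 < n"
  shows "(\<integral>\<^sup>+u. ennreal (poisson_binomial (\<lambda>k. q k + a * u) n x) * indicator {0..1} u \<partial>lborel)
    \<le> ennreal (2 / (a * n))"
proof -
  define F where "F u = poisson_binomial_tail (\<lambda>k. q k + a * u) n x
      + poisson_binomial_tail (\<lambda>k. q k + a * u) n (x + 1)" for u
  define f where "f u = a * poisson_binomial_tail_deriv (\<lambda>k. q k + a * u) n x
      + a * poisson_binomial_tail_deriv (\<lambda>k. q k + a * u) n (x + 1)" for u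
  let ?b = "\<lambda>u. poisson_binomial (\<lambda>k. q k + a * u) n x"
  have an: "0 < a * n" using assms by simp
  have nn: "0 \<le> ?b u" if "u \<in> {0..1}" for u
    using q that by (intro poisson_binomial_nonneg) auto
  have le: "a * n * ?b u \<le> f u" if "u \<in> {0..1}" for u
  proof -
    have "n * ?b u \<le> poisson_binomial_tail_deriv (\<lambda>k. q k + a * u) n x
        + poisson_binomial_tail_deriv (\<lambda>k. q k + a * u) n (x + 1)"
      using add_mono[OF poisson_binomial_tail_deriv_ge[of n "\<lambda>k. q k + a * u" x]] q[OF _ that]
      by (simp add: left_diff_distrib)
    then have "a * (n * ?b u) \<le> a * (poisson_binomial_tail_deriv (\<lambda>k. q k + a * u) n x
        + poisson_binomial_tail_deriv (\<lambda>k. q k + a * u) n (x + 1))"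
      using \<open>0 < a\<close> by (intro mult_left_mono) auto
    then show ?thesis by (simp add: f_def algebra_simps)
  qed
  have dF: "(F has_real_derivative f u) (at u)" for u
    unfolding F_def f_def by (intro DERIV_add DERIV_poisson_binomial_tail)
  have [measurable]: "(\<lambda>u. poisson_binomial_tail_deriv (\<lambda>k. q k + a * u) m y) \<in> borel_measurable borel"
    for m y
    by (induction m arbitrary: y) simp_all
  have [measurable]: "f \<in> borel_measurable borel"
    unfolding f_def by simp
  have "ennreal (a * n) * (\<integral>\<^sup>+u. ennreal (?b u) * indicator {0..1} u \<partial>lborel)
      = (\<integral>\<^sup>+u. ennreal (a * n) * (ennreal (?b u) * indicator {0..1} u) \<partial>lborel)"
    by (intro nn_integral_cmult[symmetric]) simp
  also have "\<dots> \<le> (\<integral>\<^sup>+u. ennreal (f u) * indicator {0..1} u \<partial>lborel)"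
    using le nn an by (intro nn_integral_mono)
      (auto split: split_indicator simp flip: ennreal_mult' intro!: ennreal_leI)
  also have "\<dots> = F 1 - F 0"
    using an nn le order_trans[OF mult_nonneg_nonneg]
    by (intro nn_integral_FTC_Icc) (auto intro!: DERIV_subset dF order_trans[OF mult_nonneg_nonneg le])
  also have "\<dots> \<le> ennreal 2"
  proof -
    have "F 1 \<le> 2" "0 \<le> F 0"
      unfolding F_def using poisson_binomial_tail_bounds[of n "\<lambda>k. q k + a * 1"]
        poisson_binomial_tail_bounds[of n "\<lambda>k. q k + a * 0"] q[of _ 0] q[of _ 1]
      by (smt (verit) atLeastAtMost_iff)+
    then show ?thesis by (intro ennreal_leI) simp
  qed
  finally have *: "ennreal (a * n) * (\<integral>\<^sup>+u. ennreal (?b u) * indicator {0..1} u \<partial>lborel) \<le> ennreal 2" .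
  have "(\<integral>\<^sup>+u. ennreal (?b u) * indicator {0..1} u \<partial>lborel)
      = ennreal (1 / (a * n)) * (ennreal (a * n) * (\<integral>\<^sup>+u. ennreal (?b u) * indicator {0..1} u \<partial>lborel))"
    using assms by (simp add: mult.assoc[symmetric] ennreal_mult'[symmetric])
  also have "\<dots> \<le> ennreal (1 / (a * n)) * ennreal 2"
    by (intro mult_left_mono *) simp
  also have "\<dots> = ennreal (2 / (a * n))"
    using an by (subst ennreal_mult'[symmetric]) auto
  finally show ?thesis .
qed

section \<open>A walk with a hierarchically perturbed slope\<close>

text \<open>Overwriting coordinate \<open>c\<close> by an independent fresh draw preserves the
  product law. This amounts to conditioning on all other coordinates without splitting the index
  set.\<close>

lemma nn_integral_PiM_resample:
  assumes "\<And>i. prob_space (M i)"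
    and [measurable]: "f \<in> borel_measurable (\<Pi>\<^sub>M i\<in>UNIV. M i)"
  shows "(\<integral>\<^sup>+w. f w \<partial>(\<Pi>\<^sub>M i\<in>UNIV. M i))
    = (\<integral>\<^sup>+w. (\<integral>\<^sup>+v. f (w(c := v)) \<partial>M c) \<partial>(\<Pi>\<^sub>M i\<in>UNIV. M i))"
proof -
  let ?P = "\<Pi>\<^sub>M i\<in>UNIV. M i"
  interpret P: prob_space ?P by (intro prob_space_PiM assms)
  interpret C: prob_space "M c" by fact
  interpret CP: pair_prob_space "M c" ?P ..
  have eq: "distr (M c \<Otimes>\<^sub>M ?P) ?P (\<lambda>(x, X). X(c := x)) = ?P"
    using distr_pair_PiM_eq_PiM[of UNIV M c] assms by (simp add: insert_UNIV)
  have [measurable]: "(\<lambda>(x, X). X(c := x)) \<in> measurable (M c \<Otimes>\<^sub>M ?P) ?P"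
    using measurable_add_dim[of c UNIV M] by (simp add: measurable_fun_upd)
  have "(\<integral>\<^sup>+w. f w \<partial>?P) = (\<integral>\<^sup>+z. f ((snd z)(c := fst z)) \<partial>(M c \<Otimes>\<^sub>M ?P))"
    by (subst eq[symmetric]) (simp add: nn_integral_distr case_prod_beta)
  also have "\<dots> = (\<integral>\<^sup>+w. (\<integral>\<^sup>+v. f (w(c := v)) \<partial>M c) \<partial>?P)"
    by (subst CP.nn_integral_snd[symmetric]) (simp_all add: case_prod_beta')
  finally show ?thesis .
qed

text \<open>The space itself is cut down to the unit interval, so bounds on samples hold everywhere
  and not just almost everywhere.\<close>

definition unit_uniform :: "real measure" where
  "unit_uniform = restrict_space lborel {0..1}"

lemma prob_space_unit_uniform: "prob_space unit_uniform"
  by standard (simp add: unit_uniform_def emeasure_restrict_space)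

lemma space_unit_uniform [simp]: "space unit_uniform = {0..1}"
  by (simp add: unit_uniform_def)

lemma nn_integral_unit_uniform:
  "(\<integral>\<^sup>+v. f v \<partial>unit_uniform) = (\<integral>\<^sup>+v. f v * indicator {0..1} v \<partial>lborel)"
  by (simp add: unit_uniform_def nn_integral_restrict_space)

lemma measurable_unit_uniform_borel [measurable]: "(\<lambda>v. v) \<in> borel_measurable unit_uniform"
  by (simp add: unit_uniform_def measurable_restrict_space1)

lemma nn_integral_unit_uniform_threshold:
  assumes "0 \<le> p" "p \<le> 1"
  shows "(\<integral>\<^sup>+v. (if v \<le> p then b else c) \<partial>unit_uniform) = ennreal p * b + ennreal (1 - p) * c"
proof -
  have "(\<integral>\<^sup>+v. (if v \<le> p then b else c) \<partial>unit_uniform)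
      = (\<integral>\<^sup>+v. b * indicator {0..p} v + c * indicator {p<..1} v \<partial>lborel)"
    unfolding nn_integral_unit_uniform using assms
    by (intro nn_integral_cong) (auto split: split_indicator)
  also have "\<dots> = b * ennreal p + c * ennreal (1 - p)"
    using assms by (subst nn_integral_add) (auto simp: nn_integral_cmult_indicator)
  finally show ?thesis by (simp add: mult.commute)
qed

text \<open>The coordinate $(j,i)$ with $j\ge1$ perturbs the slope on the dyadic block $[i2^j,(i+1)2^j)$;
  the coordinate $(0,n)$ is the coin flip of step $n$.\<close>

definition seeds :: "(nat \<times> nat \<Rightarrow> real) measure" where
  "seeds = (\<Pi>\<^sub>M i\<in>UNIV. unit_uniform)"

lemma prob_space_seeds: "prob_space seeds"
  unfolding seeds_def by (intro prob_space_PiM prob_space_unit_uniform)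

lemma space_seeds: "space seeds = {w. \<forall>c. w c \<in> {0..1}}"
  by (auto simp: seeds_def space_PiM PiE_def Pi_def)

lemma measurable_seeds_coord [measurable]: "(\<lambda>w. w c) \<in> borel_measurable seeds"
proof -
  have "(\<lambda>w. w c) \<in> measurable seeds unit_uniform"
    unfolding seeds_def by (intro measurable_component_singleton) simp
  from measurable_compose[OF this measurable_unit_uniform_borel] show ?thesis .
qed

lemma nn_integral_seeds_resample:
  assumes "f \<in> borel_measurable seeds"
  shows "(\<integral>\<^sup>+w. f w \<partial>seeds) = (\<integral>\<^sup>+w. (\<integral>\<^sup>+v. f (w(c := v)) \<partial>unit_uniform) \<partial>seeds)"
  using assms unfolding seeds_def
  by (intro nn_integral_PiM_resample prob_space_unit_uniform)

text \<open>The ratio 3/4 is below 1, so the total perturbation stays bounded, and above 1/sqrt 2,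
  so the square of \<open>2 / (amp j * 2 ^ j)\<close> decays faster than \<open>1 / 2 ^ j\<close>.
  The factor 1/3 makes the sum over j >= 1 equal to 1.\<close>

definition amp :: "nat \<Rightarrow> real" where
  "amp j = (3 / 4) ^ j / 3"

text \<open>Truncating the sum at \<^term>\<open>n\<close> keeps every block with $i\ge1$ that contains \<^term>\<open>n\<close>, since
  then $j<2^j\le n$.\<close>

definition slope :: "(nat \<times> nat \<Rightarrow> real) \<Rightarrow> nat \<Rightarrow> real" where
  "slope w n = (\<Sum>j = 1..n. amp j * w (j, n div 2 ^ j))"

definition walk_step :: "(nat \<times> nat \<Rightarrow> real) \<Rightarrow> nat \<Rightarrow> int" where
  "walk_step w n = (if w (0, n) \<le> slope w n then 1 else 0)"

definition walk :: "(nat \<times> nat \<Rightarrow> real) \<Rightarrow> nat \<Rightarrow> int" where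
  "walk w t = (\<Sum>n<t. walk_step w n)"

lemma amp_pos: "0 < amp j"
  by (simp add: amp_def)

lemma sum_amp_le_1: "(\<Sum>j = 1..n. amp j) \<le> 1"
proof -
  have "(\<Sum>j = 1..n. amp j) = 1 - (3 / 4) ^ n"
    by (induction n) (auto simp: amp_def)
  then show ?thesis by simp
qed

lemma slope_bounds:
  assumes "w \<in> space seeds"
  shows "0 \<le> slope w n" "slope w n \<le> 1"
proof -
  have w: "0 \<le> w c" "w c \<le> 1" for c using assms by (auto simp: space_seeds simp del: split_paired_All)
  show "0 \<le> slope w n"
    unfolding slope_def using w amp_pos by (intro sum_nonneg mult_nonneg_nonneg) (auto intro: less_imp_le)
  have "slope w n \<le> (\<Sum>j = 1..n. amp j * 1)"
    unfolding slope_def using w amp_pos by (intro sum_mono mult_left_mono) (auto intro: less_imp_le)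
  then show "slope w n \<le> 1" using sum_amp_le_1[of n] by simp
qed

lemma measurable_slope [measurable]: "(\<lambda>w. slope w n) \<in> borel_measurable seeds"
  unfolding slope_def by measurable

lemma measurable_walk_step [measurable]: "(\<lambda>w. walk_step w n) \<in> measurable seeds (count_space UNIV)"
  unfolding walk_step_def by measurable

lemma measurable_walk [measurable]: "(\<lambda>w. walk w t) \<in> measurable seeds (count_space UNIV)"
  unfolding walk_def by (induction t) simp_all

lemma slope_upd_leaf [simp]: "slope (w((0, l) := v)) n = slope w n"
  unfolding slope_def by (intro sum.cong) auto

lemma walk_step_upd_leaf: "n \<noteq> l \<Longrightarrow> walk_step (w((0, l) := v)) n = walk_step w n"
  by (simp add: walk_step_def)

lemma slope_upd_outside:
  assumes "n \<notin> {i * 2 ^ j..<(i + 1) * 2 ^ j}"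
  shows "slope (w((j, i) := v)) n = slope w n"
proof -
  have "n div 2 ^ j \<noteq> i"
    using assms div_times_less_eq_dividend[of n "2 ^ j"] dividend_less_div_times[of "2 ^ j" n]
    by auto
  then show ?thesis unfolding slope_def by (intro sum.cong) auto
qed

lemma walk_step_upd_outside:
  assumes "n \<notin> {i * 2 ^ j..<(i + 1) * 2 ^ j}" "1 \<le> j"
  shows "walk_step (w((j, i) := v)) n = walk_step w n"
  using assms by (simp add: walk_step_def slope_upd_outside)

lemma slope_upd_inside:
  assumes n: "n \<in> {i * 2 ^ j..<(i + 1) * 2 ^ j}" and "1 \<le> j" "1 \<le> i"
  shows "slope (w((j, i) := v)) n = slope (w((j, i) := 0)) n + amp j * v"
proof -
  have d: "n div 2 ^ j = i"
    using n by (intro div_nat_eqI) (auto simp: algebra_simps)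
  have "j < 2 ^ j" by simp
  also have "2 ^ j \<le> i * 2 ^ j" using \<open>1 \<le> i\<close> by simp
  also have "\<dots> \<le> n" using n by simp
  finally have j: "j \<in> {1..n}" using \<open>1 \<le> j\<close> by simp
  have "slope (w((j, i) := u)) n
      = amp j * u + (\<Sum>k\<in>{1..n} - {j}. amp k * w (k, n div 2 ^ k))" for u
    unfolding slope_def using j d
    by (subst sum.remove[of _ j]) (auto intro!: sum.cong)
  then show ?thesis by simp
qed

text \<open>\<open>E\<close> stands for the past up to time \<open>s\<close>. Its probability
  factors out because only coordinates of a block after \<open>s\<close> are resampled: first the
  coins, then the shift.\<close>

lemma walk_anticoncentration:
  assumes E [measurable]: "Measurable.pred seeds E"
    and past: "\<And>w w'. (\<And>n. n < s \<Longrightarrow> walk_step w n = walk_step w' n) \<Longrightarrow> E w = E w'"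
    and "1 \<le> j" "s + 2 ^ Suc j \<le> t"
  shows "emeasure seeds {w \<in> space seeds. E w \<and> walk w t = a}
    \<le> ennreal (2 / (amp j * 2 ^ j)) * emeasure seeds {w \<in> space seeds. E w}"
proof -
  \<comment> \<open>The next block of length \<open>2 ^ j\<close> starts at most
    \<open>2 ^ j\<close> after \<open>s\<close>, hence ends by \<open>s + 2 ^ Suc j\<close>. Adding
    1 also ensures \<open>1 \<le> i\<close>, so that the block's perturbation survives the
    truncation in \<open>slope\<close>.\<close>
  define i where "i = s div 2 ^ j + 1"
  define l where "l = i * 2 ^ j"
  have "1 \<le> i" by (simp add: i_def)
  have "s \<le> l"
    using dividend_less_div_times[of "2 ^ j" s] by (simp add: l_def i_def)
  have lt: "l + 2 ^ j \<le> t"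
  proof -
    have "s div 2 ^ j * 2 ^ j \<le> s" by simp
    then show ?thesis
      using assms(4) unfolding l_def i_def add_mult_distrib power_Suc by linarith
  qed
  define D where "D n w = (\<Sum>k\<in>{..<t} - {l..<l + n}. walk_step w k)" for n w
  \<comment> \<open>The conditional probability of the event when the first \<open>n\<close> coins
    of the block are redrawn; for n = 0 it is the indicator of the event.\<close>
  define G where "G n w = (if E w then
      ennreal (poisson_binomial (\<lambda>k. slope w (l + k)) n (a - D n w)) else 0)" for n w
  have [measurable]: "D n \<in> measurable seeds (count_space UNIV)" for n
  proof -
    have "finite A \<Longrightarrow> (\<lambda>w. \<Sum>k\<in>A. walk_step w k) \<in> measurable seeds (count_space UNIV)"
      for A by (induction A rule: finite_induct) simp_all
    then show ?thesis unfolding D_def by simp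
  qed
  have [measurable]: "G n \<in> borel_measurable seeds" for n
    unfolding G_def by measurable
  have pb_nonneg: "0 \<le> poisson_binomial (\<lambda>k. slope w (l + k)) n x" if "w \<in> space seeds" for w n x
    using slope_bounds[OF that] by (intro poisson_binomial_nonneg) simp
  \<comment> \<open>Resampling the coin flips of the block one after the other turns the law of their number of
    successes into a Poisson binomial law; \<^term>\<open>D n\<close> collects the steps not yet integrated out.\<close>
  have integrate_leaves: "emeasure seeds {w \<in> space seeds. E w \<and> walk w t = a} = (\<integral>\<^sup>+w. G n w \<partial>seeds)"
    if "n \<le> 2 ^ j" for n
    using that
  proof (induction n)
    case 0
    have "(\<integral>\<^sup>+w. G 0 w \<partial>seeds)
        = (\<integral>\<^sup>+w. indicator {w \<in> space seeds. E w \<and> walk w t = a} w \<partial>seeds)"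
      by (intro nn_integral_cong) (auto simp: G_def D_def walk_def split: split_indicator)
    then show ?case by simp
  next
    case (Suc n)
    have ln: "l + n < t" using Suc.prems lt by linarith
    have step: "(\<integral>\<^sup>+v. G n (w((0, l + n) := v)) \<partial>unit_uniform) = G (Suc n) w"
      if w: "w \<in> space seeds" for w
    proof -
      let ?P = "poisson_binomial (\<lambda>k. slope w (l + k)) n"
      define x where "x = a - D (Suc n) w"
      have D: "D n (w((0, l + n) := v)) = D (Suc n) w + (if v \<le> slope w (l + n) then 1 else 0)" for v
      proof -
        have "{..<t} - {l..<l + n} = insert (l + n) ({..<t} - {l..<l + Suc n})"
          using ln by auto
        then have "D n (w((0, l + n) := v)) = walk_step (w((0, l + n) := v)) (l + n)
            + (\<Sum>k\<in>{..<t} - {l..<l + Suc n}. walk_step (w((0, l + n) := v)) k)"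
          unfolding D_def by simp
        also have "(\<Sum>k\<in>{..<t} - {l..<l + Suc n}. walk_step (w((0, l + n) := v)) k) = D (Suc n) w"
          unfolding D_def by (intro sum.cong) (auto intro!: walk_step_upd_leaf)
        finally show ?thesis
          unfolding walk_step_def slope_upd_leaf by (simp only: fun_upd_same add.commute)
      qed
      have EE: "E (w((0, l + n) := v)) = E w" for v
        using \<open>s \<le> l\<close> by (intro past walk_step_upd_leaf) auto
      have "(\<integral>\<^sup>+v. G n (w((0, l + n) := v)) \<partial>unit_uniform)
          = (\<integral>\<^sup>+v. (if v \<le> slope w (l + n) then (if E w then ennreal (?P (x - 1)) else 0)
              else (if E w then ennreal (?P x) else 0)) \<partial>unit_uniform)"
        by (intro nn_integral_cong) (auto simp: G_def EE D x_def algebra_simps)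
      also have "\<dots> = ennreal (slope w (l + n)) * (if E w then ennreal (?P (x - 1)) else 0)
          + ennreal (1 - slope w (l + n)) * (if E w then ennreal (?P x) else 0)"
        using slope_bounds[OF w] by (rule nn_integral_unit_uniform_threshold)
      also have "\<dots> = G (Suc n) w"
        using slope_bounds[OF w, of "l + n"] pb_nonneg[OF w]
        by (auto simp: G_def x_def ennreal_mult' ennreal_plus)
      finally show ?thesis .
    qed
    have "(\<integral>\<^sup>+w. G n w \<partial>seeds) = (\<integral>\<^sup>+w. G (Suc n) w \<partial>seeds)"
      by (subst nn_integral_seeds_resample[where c = "(0, l + n)"])
        (auto intro!: nn_integral_cong step)
    with Suc show ?case by simp
  qed
  \<comment> \<open>Once the coins are integrated out, coordinate \<open>(j, i)\<close> acts only as
    a common shift of the slopes in the block, so the smoothing bound applies.\<close>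
  have average: "(\<integral>\<^sup>+u. G (2 ^ j) (w((j, i) := u)) \<partial>unit_uniform)
      \<le> ennreal (2 / (amp j * 2 ^ j)) * indicator {w \<in> space seeds. E w} w"
    if w: "w \<in> space seeds" for w
  proof -
    define q where "q k = slope (w((j, i) := 0)) (l + k)" for k
    have upd: "w((j, i) := u) \<in> space seeds" if "u \<in> {0..1}" for u
      using w that by (auto simp: space_seeds)
    have q: "slope (w((j, i) := u)) (l + k) = q k + amp j * u" if "k < 2 ^ j" for k u
      unfolding q_def using that \<open>1 \<le> j\<close> \<open>1 \<le> i\<close>
      by (intro slope_upd_inside) (auto simp: l_def)
    have EE: "E (w((j, i) := u)) = E w" for u
      using \<open>s \<le> l\<close> \<open>1 \<le> j\<close> by (intro past walk_step_upd_outside) (auto simp: l_def)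
    have D: "D (2 ^ j) (w((j, i) := u)) = D (2 ^ j) w" for u
      unfolding D_def using \<open>1 \<le> j\<close>
      by (intro sum.cong refl walk_step_upd_outside) (auto simp: l_def)
    have "(\<integral>\<^sup>+u. G (2 ^ j) (w((j, i) := u)) \<partial>unit_uniform)
        = (\<integral>\<^sup>+u. (if E w then ennreal (poisson_binomial (\<lambda>k. q k + amp j * u) (2 ^ j)
            (a - D (2 ^ j) w)) else 0) * indicator {0..1} u \<partial>lborel)"
      unfolding nn_integral_unit_uniform G_def EE D
      by (intro nn_integral_cong arg_cong2[where f = "(*)"] if_cong refl
          arg_cong[where f = ennreal] poisson_binomial_cong q)
    also have "\<dots> \<le> ennreal (2 / (amp j * 2 ^ j)) * indicator {w \<in> space seeds. E w} w"
    proof (cases "E w")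
      case True
      have "0 \<le> q k + amp j * u \<and> q k + amp j * u \<le> 1" if "k < 2 ^ j" "u \<in> {0..1}" for k u
        using slope_bounds[OF upd[OF that(2)]] q[OF that(1), of u] by metis
      from poisson_binomial_smoothing[where n = "2 ^ j" and x = "a - D (2 ^ j) w", OF this amp_pos]
      show ?thesis using True w by simp
    qed simp
    finally show ?thesis .
  qed
  have "emeasure seeds {w \<in> space seeds. E w \<and> walk w t = a}
      = (\<integral>\<^sup>+w. (\<integral>\<^sup>+u. G (2 ^ j) (w((j, i) := u)) \<partial>unit_uniform) \<partial>seeds)"
    using integrate_leaves[of "2 ^ j"] by (simp add: nn_integral_seeds_resample[where c = "(j, i)"])
  also have "\<dots> \<le> (\<integral>\<^sup>+w. ennreal (2 / (amp j * 2 ^ j)) * indicator {w \<in> space seeds. E w} w \<partial>seeds)"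
    by (intro nn_integral_mono average)
  also have "\<dots> = ennreal (2 / (amp j * 2 ^ j)) * emeasure seeds {w \<in> space seeds. E w}"
    by (intro nn_integral_cmult_indicator) simp
  finally show ?thesis .
qed

section \<open>Meetings along widely spaced times\<close>

text \<open>The anticoncentration bound for a gap \<open>k\<close>: with
  \<open>j = floor_log k - 1\<close> one has \<open>2 ^ Suc j \<le> k\<close> as soon as
  \<open>4 \<le> k\<close>, which also gives \<open>1 \<le> j\<close>.\<close>

definition decay :: "nat \<Rightarrow> real" where
  "decay k = 6 * (2 / 3) ^ (floor_log k - 1)"

lemma decay_pos: "0 < decay k"
  by (simp add: decay_def)

lemma decay_eq: "decay k = 2 / (amp (floor_log k - 1) * 2 ^ (floor_log k - 1))"
proof -
  have "amp j * 2 ^ j = (3 / 2) ^ j / 3" for j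
    unfolding amp_def times_divide_eq_left by (subst power_mult_distrib[symmetric]) simp
  then show ?thesis by (simp add: decay_def power_divide)
qed

text \<open>Cauchy condensation leaves a geometric series of ratio 2 * (2/3)^2 = 8/9.\<close>

lemma summable_decay_sq: "summable (\<lambda>k. (decay k)\<^sup>2)"
proof -
  have "(decay (Suc k))\<^sup>2 \<le> (decay k)\<^sup>2" for k
  proof -
    have "floor_log k - 1 \<le> floor_log (Suc k) - 1"
      using floor_log_le_iff[of k "Suc k"] by simp
    then have "decay (Suc k) \<le> decay k"
      unfolding decay_def by (intro mult_left_mono power_decreasing) auto
    then show ?thesis using decay_pos by (intro power_mono) (auto intro: less_imp_le)
  qed
  moreover have "summable (\<lambda>n. 2 ^ n * (decay (2 ^ n))\<^sup>2)"
  proof -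
    \<comment> \<open>The shift by one avoids the truncated subtraction in \<open>decay\<close> at k
      = 1.\<close>
    have "2 ^ Suc n * (decay (2 ^ Suc n))\<^sup>2 = 72 * (8 / 9) ^ n" for n
    proof -
      have "decay (2 ^ Suc n) = 6 * (2 / 3) ^ n"
        unfolding decay_def by (simp only: floor_log_power) simp
      then have "2 ^ Suc n * (decay (2 ^ Suc n))\<^sup>2 = 72 * (2 * (2 / 3)\<^sup>2) ^ n"
        by (simp add: power_mult_distrib flip: power_mult) (simp add: mult.commute power_mult)
      then show ?thesis by (simp add: power2_eq_square)
    qed
    moreover have "summable (\<lambda>n. 72 * (8 / 9 :: real) ^ n)"
      by (intro summable_mult summable_geometric) simp
    ultimately have "summable (\<lambda>n. 2 ^ Suc n * (decay (2 ^ Suc n))\<^sup>2)" by (simp only:)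
    then show ?thesis by (subst (asm) summable_Suc_iff)
  qed
  ultimately show ?thesis
    by (subst condensation_test) auto
qed

lemma decay_sq_tail:
  obtains M where "4 \<le> M" "\<And>T. (\<Sum>k = M..T. (decay k)\<^sup>2) \<le> 1 / 2"
proof -
  obtain N where N: "\<And>m n. m \<ge> N \<Longrightarrow> norm (\<Sum>k = m..<n. (decay k)\<^sup>2) < 1 / 2"
    using summable_decay_sq unfolding summable_Cauchy by (meson half_gt_zero_iff zero_less_one)
  have "(\<Sum>k = max 4 N..T. (decay k)\<^sup>2) \<le> 1 / 2" for T
    using N[of "max 4 N" "Suc T"] by (simp add: atLeastLessThanSuc_atLeastAtMost abs_less_iff)
  then show ?thesis using that[of "max 4 N"] by simp
qed

text \<open>A list \<^term>\<open>ks\<close> of gaps encodes the increasing times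
  \<open>s + k\<^sub>1 < s + k\<^sub>1 + k\<^sub>2 < \<dots>\<close>.\<close>

fun agree_along :: "(nat \<Rightarrow> 'a) \<Rightarrow> (nat \<Rightarrow> 'a) \<Rightarrow> nat \<Rightarrow> nat list \<Rightarrow> bool" where
  "agree_along x y s [] \<longleftrightarrow> True"
| "agree_along x y s (k # ks) \<longleftrightarrow> x (s + k) = y (s + k) \<and> agree_along x y (s + k) ks"

lemma agree_along_snoc:
  "agree_along x y s (ks @ [k]) \<longleftrightarrow>
     agree_along x y s ks \<and> x (s + sum_list ks + k) = y (s + sum_list ks + k)"
  by (induction ks arbitrary: s) (auto simp: add.assoc)

lemma agree_along_cong:
  "(\<And>t. t \<le> s + sum_list ks \<Longrightarrow> x t = x' t) \<Longrightarrow> agree_along x y s ks = agree_along x' y s ks"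
  by (induction ks arbitrary: s) (auto simp: add.assoc)

text \<open>Greedy choice: the next time is the least element of \<open>H\<close> that is at least
  \<open>s + M\<close>. At most \<open>M\<close> elements are skipped per round, and the strict
  inequality keeps the remainder nonempty.\<close>

lemma exists_gaps:
  assumes "finite H" "m * M < card H" "\<And>h. h \<in> H \<Longrightarrow> s \<le> h" "\<And>h. h \<in> H \<Longrightarrow> x h = y h"
  shows "\<exists>ks. length ks = m \<and> (\<forall>k\<in>set ks. M \<le> k) \<and> agree_along x y s ks"
  using assms
proof (induction m arbitrary: H s)
  case (Suc m)
  define H' where "H' = {h \<in> H. s + M \<le> h}"
  have "H \<subseteq> {s..<s + M} \<union> H'"
    using Suc.prems(3) by (auto simp: H'_def)
  then have "card H \<le> card ({s..<s + M} \<union> H')"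
    using Suc.prems(1) by (intro card_mono) (auto simp: H'_def)
  also have "\<dots> \<le> M + card H'"
    using card_Un_le[of "{s..<s + M}" H'] by simp
  finally have card: "m * M < card H'" using Suc.prems(2) by simp
  have fin: "finite H'" using Suc.prems(1) by (simp add: H'_def)
  have "H' \<noteq> {}" using card by auto
  then have Min: "Min H' \<in> H'" using fin by simp
  obtain ks where ks: "length ks = m" "\<forall>k\<in>set ks. M \<le> k" "agree_along x y (Min H') ks"
    using Suc.IH[OF fin card, of "Min H'"] fin Suc.prems(4) by (auto simp: H'_def)
  show ?case
    using ks Min Suc.prems(4)[of "Min H'"]
    by (intro exI[of _ "(Min H' - s) # ks"]) (auto simp: H'_def)
qed auto

lemma pred_agree_along_walk [measurable]:
  "Measurable.pred seeds (\<lambda>w. agree_along (walk w) \<alpha> s ks)"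
  by (induction ks arbitrary: s) simp_all

text \<open>The induction removes the last gap, since anticoncentration conditions on the past:
  agreement along the earlier gaps depends only on steps before their sum.\<close>

lemma prob_agree_along_walk:
  assumes "\<forall>k\<in>set ks. 4 \<le> k"
  shows "emeasure seeds {w \<in> space seeds. agree_along (walk w) \<alpha> 0 ks}
    \<le> ennreal (prod_list (map decay ks))"
  using assms
proof (induction ks rule: rev_induct)
  case Nil
  show ?case using prob_space.emeasure_space_1[OF prob_space_seeds] by simp
next
  case (snoc k ks)
  define s where "s = sum_list ks"
  define j where "j = floor_log k - 1"
  have "floor_log 4 \<le> floor_log k"
    using snoc.prems by (intro floor_log_le_iff) simp
  then have j: "1 \<le> j" "Suc j = floor_log k"
    using floor_log_power[of 2] by (simp_all add: j_def)
  then have "2 ^ Suc j \<le> k"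
    using snoc.prems floor_log_exp2_le[of k] by auto
  have past: "agree_along (walk w) \<alpha> 0 ks = agree_along (walk w') \<alpha> 0 ks"
    if "\<And>n. n < s \<Longrightarrow> walk_step w n = walk_step w' n" for w w'
    using that by (intro agree_along_cong) (auto simp: s_def walk_def intro!: sum.cong)
  have "emeasure seeds {w \<in> space seeds. agree_along (walk w) \<alpha> 0 (ks @ [k])}
      = emeasure seeds {w \<in> space seeds. agree_along (walk w) \<alpha> 0 ks \<and> walk w (s + k) = \<alpha> (s + k)}"
    by (simp add: agree_along_snoc s_def)
  also have "\<dots> \<le> ennreal (decay k) * emeasure seeds {w \<in> space seeds. agree_along (walk w) \<alpha> 0 ks}"
    unfolding decay_eq j_def[symmetric] using j(1) \<open>2 ^ Suc j \<le> k\<close>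
    by (intro walk_anticoncentration past) auto
  also have "\<dots> \<le> ennreal (decay k) * ennreal (prod_list (map decay ks))"
    using snoc by (intro mult_left_mono) auto
  also have "\<dots> = ennreal (prod_list (map decay (ks @ [k])))"
    by (simp add: ennreal_mult''[OF less_imp_le[OF decay_pos]] mult.commute[of "ennreal (decay k)"])
  finally show ?case .
qed

lemma sum_prod_list_eq_power:
  fixes f :: "'a \<Rightarrow> 'b :: comm_semiring_1"
  assumes "finite A"
  shows "(\<Sum>ks | set ks \<subseteq> A \<and> length ks = m. prod_list (map f ks)) = (\<Sum>k\<in>A. f k) ^ m"
proof (induction m)
  case 0
  have "{ks. set ks \<subseteq> A \<and> length ks = 0} = {[]}" by auto
  then show ?case by simp
next
  case (Suc m)
  have "(\<Sum>ks | set ks \<subseteq> A \<and> length ks = Suc m. prod_list (map f ks))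
      = (\<Sum>(ks, k)\<in>{ks. set ks \<subseteq> A \<and> length ks = m} \<times> A. prod_list (map f ks) * f k)"
    unfolding lists_length_Suc_eq
    by (subst sum.reindex) (auto simp: inj_on_def case_prod_beta mult.commute)
  also have "\<dots> = (\<Sum>ks | set ks \<subseteq> A \<and> length ks = m. prod_list (map f ks)) * (\<Sum>k\<in>A. f k)"
    by (simp add: sum_product sum.cartesian_product)
  finally show ?case using Suc by (simp add: mult.commute)
qed

text \<open>Independence of the two walks squares each factor. For gaps up to \<open>T\<close> the
  union bound sums to the m-th power of a sum that is at most 1/2; continuity from below then
  removes \<open>T\<close>.\<close>

lemma prob_exists_gaps:
  fixes \<alpha> \<beta> :: "nat \<Rightarrow> int"
  assumes M: "4 \<le> M" "\<And>T. (\<Sum>k = M..T. (decay k)\<^sup>2) \<le> 1 / 2"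
  defines "V \<equiv> \<lambda>ks. {z \<in> space (seeds \<Otimes>\<^sub>M seeds).
      agree_along (walk (fst z)) \<alpha> 0 ks \<and> agree_along (walk (snd z)) \<beta> 0 ks}"
  shows "(\<Union>ks\<in>{ks. length ks = m \<and> (\<forall>k\<in>set ks. M \<le> k)}. V ks) \<in> sets (seeds \<Otimes>\<^sub>M seeds)"
    and "emeasure (seeds \<Otimes>\<^sub>M seeds) (\<Union>ks\<in>{ks. length ks = m \<and> (\<forall>k\<in>set ks. M \<le> k)}. V ks)
      \<le> ennreal ((1 / 2) ^ m)"
proof -
  interpret S: prob_space seeds by (rule prob_space_seeds)
  have [measurable]: "V ks \<in> sets (seeds \<Otimes>\<^sub>M seeds)" for ks
    unfolding V_def by measurable
  show "(\<Union>ks\<in>{ks. length ks = m \<and> (\<forall>k\<in>set ks. M \<le> k)}. V ks) \<in> sets (seeds \<Otimes>\<^sub>M seeds)"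
    by (intro sets.countable_UN'') auto
  define L where "L T = {ks. set ks \<subseteq> {M..T} \<and> length ks = m}" for T
  have finL: "finite (L T)" for T unfolding L_def by (intro finite_lists_length_eq) simp
  have V: "emeasure (seeds \<Otimes>\<^sub>M seeds) (V ks) \<le> ennreal (prod_list (map (\<lambda>k. (decay k)\<^sup>2) ks))"
    if "\<forall>k\<in>set ks. M \<le> k" for ks
  proof -
    have ks: "\<forall>k\<in>set ks. 4 \<le> k" using that M(1) by force
    have "V ks = {w \<in> space seeds. agree_along (walk w) \<alpha> 0 ks}
        \<times> {w \<in> space seeds. agree_along (walk w) \<beta> 0 ks}"
      by (auto simp: V_def space_pair_measure)
    then have "emeasure (seeds \<Otimes>\<^sub>M seeds) (V ks)
        = emeasure seeds {w \<in> space seeds. agree_along (walk w) \<alpha> 0 ks}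
          * emeasure seeds {w \<in> space seeds. agree_along (walk w) \<beta> 0 ks}"
      by (simp add: S.emeasure_pair_measure_Times)
    also have "\<dots> \<le> ennreal (prod_list (map decay ks)) * ennreal (prod_list (map decay ks))"
      by (intro mult_mono prob_agree_along_walk ks) auto
    also have "\<dots> = ennreal (prod_list (map (\<lambda>k. (decay k)\<^sup>2) ks))"
    proof -
      have "0 \<le> prod_list (map decay ks)"
        by (intro prod_list_nonneg) (auto intro: less_imp_le decay_pos)
      moreover have "prod_list (map (\<lambda>k. (decay k)\<^sup>2) ks)
          = prod_list (map decay ks) * prod_list (map decay ks)"
        by (induction ks) (simp_all add: power2_eq_square)
      ultimately show ?thesis by (simp add: ennreal_mult')
    qed
    finally show ?thesis .
  qed
  have bound: "emeasure (seeds \<Otimes>\<^sub>M seeds) (\<Union>ks\<in>L T. V ks) \<le> ennreal ((1 / 2) ^ m)" for T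
  proof -
    have "emeasure (seeds \<Otimes>\<^sub>M seeds) (\<Union>ks\<in>L T. V ks)
        \<le> (\<Sum>ks\<in>L T. emeasure (seeds \<Otimes>\<^sub>M seeds) (V ks))"
      by (intro emeasure_subadditive_finite finL) auto
    also have "\<dots> \<le> (\<Sum>ks\<in>L T. ennreal (prod_list (map (\<lambda>k. (decay k)\<^sup>2) ks)))"
      by (intro sum_mono V) (auto simp: L_def)
    also have "\<dots> = ennreal (\<Sum>ks\<in>L T. prod_list (map (\<lambda>k. (decay k)\<^sup>2) ks))"
      by (intro sum_ennreal prod_list_nonneg) auto
    also have "\<dots> = ennreal ((\<Sum>k = M..T. (decay k)\<^sup>2) ^ m)"
      unfolding L_def by (subst sum_prod_list_eq_power) auto
    also have "\<dots> \<le> ennreal ((1 / 2) ^ m)"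
      by (intro ennreal_leI power_mono M(2) sum_nonneg) auto
    finally show ?thesis .
  qed
  have "incseq (\<lambda>T. \<Union>ks\<in>L T. V ks)"
    by (intro monoI UN_mono) (force simp: L_def)+
  then have "emeasure (seeds \<Otimes>\<^sub>M seeds) (\<Union>T. \<Union>ks\<in>L T. V ks)
      = (SUP T. emeasure (seeds \<Otimes>\<^sub>M seeds) (\<Union>ks\<in>L T. V ks))"
    using finL by (intro SUP_emeasure_incseq[symmetric]) (auto intro!: sets.finite_UN)
  also have "\<dots> \<le> ennreal ((1 / 2) ^ m)"
    by (intro SUP_least bound)
  also have "(\<Union>T. \<Union>ks\<in>L T. V ks) = (\<Union>ks\<in>{ks. length ks = m \<and> (\<forall>k\<in>set ks. M \<le> k)}. V ks)"
  proof -
    \<comment> \<open>For the empty list \<open>Max\<close> is unspecified, which is harmless: that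
      list meets the entry bound for every \<open>T\<close>.\<close>
    have "ks \<in> L (Max (set ks))" if "length ks = m" "\<forall>k\<in>set ks. M \<le> k" for ks
      using that by (auto simp: L_def)
    then show ?thesis by (fastforce simp: L_def)
  qed
  finally show "emeasure (seeds \<Otimes>\<^sub>M seeds)
      (\<Union>ks\<in>{ks. length ks = m \<and> (\<forall>k\<in>set ks. M \<le> k)}. V ks) \<le> ennreal ((1 / 2) ^ m)" .
qed

section \<open>Oriented paths\<close>

text \<open>\<^typ>\<open>int ^ 'd\<close> is not an instance of \<^class>\<open>second_countable_topology\<close>, so the library's
  coordinatewise criterion for product spaces does not apply.\<close>

lemma borel_measurable_int_vec_sequence:
  fixes f :: "'a \<Rightarrow> nat \<Rightarrow> int ^ 'd"
  assumes "\<And>n a. {z \<in> space M. f z n = a} \<in> sets M"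
  shows "f \<in> borel_measurable M"
proof (rule borel_measurableI)
  fix S :: "(nat \<Rightarrow> int ^ 'd) set"
  assume "open S"
  \<comment> \<open>Cylinders over finite initial segments: there are countably many, and every open
    set is the union of those it contains.\<close>
  define Z where "Z l = {y :: nat \<Rightarrow> int ^ 'd. \<forall>n<length l. y n = l ! n}" for l
  have cyl: "\<exists>l. y \<in> Z l \<and> Z l \<subseteq> S" if "y \<in> S" for y
  proof -
    have "openin (product_topology (\<lambda>_. euclidean) UNIV) S"
      using \<open>open S\<close> by (simp add: open_fun_def)
    from product_topology_open_contains_basis[OF this \<open>y \<in> S\<close>]
    obtain X where X: "y \<in> Pi\<^sub>E UNIV X" "finite {i. X i \<noteq> UNIV}" "Pi\<^sub>E UNIV X \<subseteq> S"
      by auto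
    obtain N where N: "\<And>i. i \<ge> N \<Longrightarrow> X i = UNIV"
      using X(2) by (metis (mono_tags, lifting) finite_nat_set_iff_bounded leD mem_Collect_eq)
    have "Z (map y [0..<N]) \<subseteq> Pi\<^sub>E UNIV X"
    proof
      fix y' assume y': "y' \<in> Z (map y [0..<N])"
      have "y' i \<in> X i" for i
        using y' X(1) N[of i] by (cases "i < N") (auto simp: Z_def PiE_iff)
      then show "y' \<in> Pi\<^sub>E UNIV X" by auto
    qed
    then show ?thesis using X(3) by (intro exI[of _ "map y [0..<N]"]) (auto simp: Z_def)
  qed
  have "f -` S \<inter> space M
      = (\<Union>l\<in>{l. Z l \<subseteq> S}. {z \<in> space M. \<forall>n<length l. f z n = l ! n})"
    using cyl by (auto simp: Z_def) blast
  also have "\<dots> \<in> sets M"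
  proof (intro sets.countable_UN'' sets.sets_Collect_finite_All)
    show "countable {l. Z l \<subseteq> S}" by simp
  qed (use assms in auto)
  finally show "f -` S \<inter> space M \<in> sets M" .
qed

text \<open>A vertex thus determines the time of its visit, so two oriented paths can share a vertex
  only at equal times.\<close>

lemma oriented_path_coordinate_sum:
  fixes y :: "nat \<Rightarrow> int ^ 'd"
  assumes "y \<in> oriented_paths"
  shows "(\<Sum>i\<in>UNIV. y n $ i) = int n"
proof (induction n)
  case 0
  show ?case using assms by (simp add: oriented_paths_def)
next
  case (Suc n)
  have "\<And>k. 1 \<le> k \<Longrightarrow> \<exists>i. y k - y (k - 1) = axis i 1"
    using assms by (simp add: oriented_paths_def)
  from this[of "Suc n"] obtain i where "y (Suc n) - y n = axis i 1" by auto
  then have "y (Suc n) = axis i 1 + y n" by (simp only: diff_eq_eq)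
  then show ?case using Suc by (simp add: sum.distrib axis_def)
qed

text \<open>Edges are unordered, but matching them in reverse would force \<open>m = Suc m'\<close>
  and \<open>Suc m = m'\<close>.\<close>

lemma common_edge_same_time:
  fixes \<phi> \<psi> :: "nat \<Rightarrow> int ^ 'd"
  assumes "\<phi> \<in> oriented_paths" "\<psi> \<in> oriented_paths"
    and "{\<phi> m, \<phi> (Suc m)} = {\<psi> m', \<psi> (Suc m')}"
  shows "m = m'" "\<phi> m = \<psi> m" "\<phi> (Suc m) = \<psi> (Suc m)"
proof -
  note \<phi> = oriented_path_coordinate_sum[OF assms(1)]
  note \<psi> = oriented_path_coordinate_sum[OF assms(2)]
  have same: "n = n'" if "\<phi> n = \<psi> n'" for n n'
  proof -
    have "int n = int n'"
      using \<phi>[of n] \<psi>[of n'] unfolding that by simp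
    then show ?thesis by simp
  qed
  consider "\<phi> m = \<psi> m'" "\<phi> (Suc m) = \<psi> (Suc m')"
    | "\<phi> m = \<psi> (Suc m')" "\<phi> (Suc m) = \<psi> m'"
    using assms(3) unfolding doubleton_eq_iff by blast
  then have "m = m' \<and> \<phi> m = \<psi> m \<and> \<phi> (Suc m) = \<psi> (Suc m)"
  proof cases
    case 1
    have "m = m'" by (rule same[OF 1(1)])
    with 1 show ?thesis by simp
  next
    case 2
    from same[OF 2(1)] same[OF 2(2)] show ?thesis by linarith
  qed
  then show "m = m'" "\<phi> m = \<psi> m" "\<phi> (Suc m) = \<psi> (Suc m)" by blast+
qed

text \<open>One endpoint of a common edge is visited at an even time, and each even time serves at
  most two edges, the one before and the one after. At even times both walks that drive the random
  path have made the same number of steps.\<close>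

lemma common_edges_even_meetings:
  fixes \<phi> \<psi> :: "nat \<Rightarrow> int ^ 'd"
  assumes paths: "\<phi> \<in> oriented_paths" "\<psi> \<in> oriented_paths"
    and "enat n \<le> num_common_edges \<phi> \<psi>"
  obtains H where "finite H" "n \<le> 2 * card H" "\<And>t. t \<in> H \<Longrightarrow> \<phi> (2 * t) = \<psi> (2 * t)"
proof -
  obtain F where F: "finite F" "card F = n" "F \<subseteq> path_edges \<phi>" "F \<subseteq> path_edges \<psi>"
    using assms(3) by (auto simp: le_num_common_edges_iff)
  have "\<exists>m. e = {\<phi> m, \<phi> (Suc m)} \<and> \<phi> m = \<psi> m \<and> \<phi> (Suc m) = \<psi> (Suc m)" if e: "e \<in> F" for e
  proof -
    obtain m where "e = {\<phi> m, \<phi> (Suc m)}"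
      using e F(3) by (auto simp: path_edges_def)
    moreover obtain m' where "e = {\<psi> m', \<psi> (Suc m')}"
      using e F(4) by (auto simp: path_edges_def)
    ultimately show ?thesis using common_edge_same_time[OF paths, of m m'] by blast
  qed
  then have "\<forall>e\<in>F. \<exists>m. e = {\<phi> m, \<phi> (Suc m)} \<and> \<phi> m = \<psi> m \<and> \<phi> (Suc m) = \<psi> (Suc m)"
    by blast
  from bchoice[OF this] obtain g where g: "\<forall>e\<in>F. e = {\<phi> (g e), \<phi> (Suc (g e))} \<and>
    \<phi> (g e) = \<psi> (g e) \<and> \<phi> (Suc (g e)) = \<psi> (Suc (g e))" ..
  have "inj_on g F"
  proof (rule inj_onI)
    fix e e' assume e: "e \<in> F" "e' \<in> F" "g e = g e'"
    have "e = {\<phi> (g e), \<phi> (Suc (g e))}" using g e(1) by blast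
    also have "\<dots> = {\<phi> (g e'), \<phi> (Suc (g e'))}" by (simp only: e(3))
    also have "\<dots> = e'" using g e(2) by blast
    finally show "e = e'" .
  qed
  then have card: "card (g ` F) = n" using F(2) by (simp add: card_image)
  define H where "H = (\<lambda>m. (m + 1) div 2) ` g ` F"
  have "g ` F \<subseteq> (\<lambda>t. 2 * t) ` H \<union> (\<lambda>t. 2 * t - 1) ` H"
  proof
    fix m assume "m \<in> g ` F"
    then have "(m + 1) div 2 \<in> H" by (simp add: H_def)
    moreover have "m = 2 * ((m + 1) div 2) \<or> m = 2 * ((m + 1) div 2) - 1" by linarith
    ultimately show "m \<in> (\<lambda>t. 2 * t) ` H \<union> (\<lambda>t. 2 * t - 1) ` H" by blast
  qed
  then have "card (g ` F) \<le> card ((\<lambda>t. 2 * t) ` H \<union> (\<lambda>t. 2 * t - 1) ` H)"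
    using F(1) by (intro card_mono) (auto simp: H_def)
  also have "\<dots> \<le> card H + card H"
    using F(1) by (intro order_trans[OF card_Un_le] add_mono card_image_le) (auto simp: H_def)
  finally have "n \<le> 2 * card H" using card by simp
  moreover have "\<phi> (2 * t) = \<psi> (2 * t)" if t: "t \<in> H" for t
  proof -
    obtain e where e: "e \<in> F" "t = (g e + 1) div 2" using t by (auto simp: H_def)
    then have "2 * t = g e \<or> 2 * t = Suc (g e)" by linarith
    moreover have "\<phi> (g e) = \<psi> (g e)" "\<phi> (Suc (g e)) = \<psi> (Suc (g e))" using g e(1) by blast+
    ultimately show ?thesis by auto
  qed
  moreover have "finite H" using F(1) by (simp add: H_def)
  ultimately show ?thesis using that by blast
qed

text \<open>The step from time 2k uses step k of the first walk, the step from time 2k + 1 uses step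
  k of the second. The first coordinate absorbs the zero steps, keeping the coordinate sum equal to
  \<open>m\<close>.\<close>

definition path_of :: "(nat \<times> nat \<Rightarrow> real) \<times> (nat \<times> nat \<Rightarrow> real) \<Rightarrow> nat \<Rightarrow> int ^ 3" where
  "path_of z m = vector [int m - walk (fst z) ((m + 1) div 2) - walk (snd z) (m div 2),
     walk (fst z) ((m + 1) div 2), walk (snd z) (m div 2)]"

lemma path_of_oriented: "path_of z \<in> oriented_paths"
proof -
  have "\<exists>i. path_of z n - path_of z (n - 1) = axis i 1" if n1: "1 \<le> n" for n
  proof -
    obtain m where n: "n = Suc m" using n1 by (cases n) auto
    show ?thesis
    proof (cases "even m")
      case True
      then obtain k where k: "m = 2 * k" by auto
      have "path_of z n - path_of z (n - 1)
          = (if walk_step (fst z) k = 1 then axis 2 1 else axis 1 1)"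
        by (simp add: n k path_of_def vec_eq_iff forall_3 walk_def walk_step_def axis_def)
      then show ?thesis by metis
    next
      case False
      then obtain k where k: "m = 2 * k + 1" by (auto elim: oddE)
      have "path_of z n - path_of z (n - 1)
          = (if walk_step (snd z) k = 1 then axis 3 1 else axis 1 1)"
        by (simp add: n k path_of_def vec_eq_iff forall_3 walk_def walk_step_def axis_def)
      then show ?thesis by metis
    qed
  qed
  moreover have "path_of z 0 = 0"
    by (simp add: path_of_def walk_def vec_eq_iff forall_3)
  ultimately show ?thesis by (simp add: oriented_paths_def)
qed

lemma measurable_path_of: "path_of \<in> measurable (seeds \<Otimes>\<^sub>M seeds) path_borel"
  unfolding path_borel_def
proof (rule measurable_restrict_space2)
  show "path_of \<in> space (seeds \<Otimes>\<^sub>M seeds) \<rightarrow> oriented_paths"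
    using path_of_oriented by simp
  show "path_of \<in> borel_measurable (seeds \<Otimes>\<^sub>M seeds)"
  proof (rule borel_measurable_int_vec_sequence)
    fix n and a :: "int ^ 3"
    show "{z \<in> space (seeds \<Otimes>\<^sub>M seeds). path_of z n = a} \<in> sets (seeds \<Otimes>\<^sub>M seeds)"
      unfolding path_of_def vec_eq_iff forall_3 vector_3 by measurable
  qed
qed

section \<open>Exponential tails for the law of the random path\<close>

theorem theorem1p3:
  shows "\<exists>\<mu> :: (nat \<Rightarrow> int ^ 3) measure.
    prob_space \<mu> \<and> sets \<mu> = sets path_borel \<and> exponential_intersection_tails \<mu>"
proof -
  let ?S = "seeds \<Otimes>\<^sub>M seeds"
  interpret S: prob_space seeds by (rule prob_space_seeds)
  interpret SS: pair_prob_space seeds seeds ..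
  define \<mu> where "\<mu> = distr ?S path_borel path_of"
  have sets: "sets \<mu> = sets path_borel" by (simp add: \<mu>_def)
  have space: "space \<mu> = oriented_paths"
    by (simp add: \<mu>_def path_borel_def space_restrict_space)
  interpret \<mu>: prob_space \<mu>
    unfolding \<mu>_def by (rule SS.prob_space_distr[OF measurable_path_of])
  obtain M where M: "4 \<le> M" "\<And>T. (\<Sum>k = M..T. (decay k)\<^sup>2) \<le> 1 / 2"
    by (rule decay_sq_tail) blast
  let ?X = "\<lambda>n. {(\<phi>, \<psi>) \<in> space (\<mu> \<Otimes>\<^sub>M \<mu>). num_common_edges \<phi> \<psi> \<ge> enat n}"
  \<comment> \<open>The bound is uniform over the first path, so Fubini transfers it to the product
    measure. The case \<open>m = 0\<close> is the trivial bound 1, covering small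
    \<open>n\<close>.\<close>
  have slice: "emeasure \<mu> (Pair \<phi> -` ?X n) \<le> ennreal ((1 / 2) ^ m)"
    if \<phi>: "\<phi> \<in> space \<mu>" and n: "2 * (m * M) < n \<or> m = 0" for \<phi> n m
  proof -
    \<comment> \<open>With the first path fixed, its second and third coordinates at even times are
      deterministic targets for the two walks.\<close>
    define \<alpha> where "\<alpha> t = \<phi> (2 * t) $ 2" for t
    define \<beta> where "\<beta> t = \<phi> (2 * t) $ 3" for t
    define V where "V ks = {z \<in> space ?S.
        agree_along (walk (fst z)) \<alpha> 0 ks \<and> agree_along (walk (snd z)) \<beta> 0 ks}" for ks
    have "emeasure \<mu> (Pair \<phi> -` ?X n) = emeasure ?S (path_of -` (Pair \<phi> -` ?X n) \<inter> space ?S)"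
      unfolding \<mu>_def
      by (intro emeasure_distr measurable_path_of)
        (use sets_Pair1[OF sets_num_common_edges_ge[OF sets]] in \<open>simp add: \<mu>_def\<close>)
    also have "\<dots> \<le> emeasure ?S (\<Union>ks\<in>{ks. length ks = m \<and> (\<forall>k\<in>set ks. M \<le> k)}. V ks)"
    proof (rule emeasure_mono)
      show "path_of -` (Pair \<phi> -` ?X n) \<inter> space ?S
          \<subseteq> (\<Union>ks\<in>{ks. length ks = m \<and> (\<forall>k\<in>set ks. M \<le> k)}. V ks)"
      proof
        fix z assume z: "z \<in> path_of -` (Pair \<phi> -` ?X n) \<inter> space ?S"
        then have "enat n \<le> num_common_edges \<phi> (path_of z)" by simp
        then obtain H where H: "finite H" "n \<le> 2 * card H"
          "\<And>t. t \<in> H \<Longrightarrow> \<phi> (2 * t) = path_of z (2 * t)"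
          using common_edges_even_meetings[OF _ path_of_oriented, of \<phi> n z] \<phi>
          unfolding space by blast
        have meet: "walk (fst z) t = \<alpha> t \<and> walk (snd z) t = \<beta> t" if "t \<in> H" for t
          using H(3)[OF that] by (simp add: \<alpha>_def \<beta>_def path_of_def)
        have "\<exists>ks. length ks = m \<and> (\<forall>k\<in>set ks. M \<le> k) \<and>
            agree_along (\<lambda>t. (walk (fst z) t, walk (snd z) t)) (\<lambda>t. (\<alpha> t, \<beta> t)) 0 ks"
        proof (cases "m = 0")
          case False
          then show ?thesis
            using n H meet by (intro exists_gaps[of H]) auto
        qed auto
        moreover have "agree_along (\<lambda>t. (x t, y t)) (\<lambda>t. (x' t, y' t)) s ks \<longleftrightarrow>
            agree_along x x' s ks \<and> agree_along y y' s ks" for x x' y y' :: "nat \<Rightarrow> int" and s ks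
          by (induction ks arbitrary: s) auto
        ultimately show "z \<in> (\<Union>ks\<in>{ks. length ks = m \<and> (\<forall>k\<in>set ks. M \<le> k)}. V ks)"
          using z by (auto simp: V_def)
      qed
      show "(\<Union>ks\<in>{ks. length ks = m \<and> (\<forall>k\<in>set ks. M \<le> k)}. V ks) \<in> sets ?S"
        unfolding V_def by (rule prob_exists_gaps(1)[OF M])
    qed
    also have "\<dots> \<le> ennreal ((1 / 2) ^ m)"
      unfolding V_def by (rule prob_exists_gaps(2)[OF M])
    finally show ?thesis .
  qed
  have tail: "measure (\<mu> \<Otimes>\<^sub>M \<mu>) (?X n) \<le> (1 / 2) ^ m" if "2 * (m * M) < n \<or> m = 0" for n m
  proof -
    have "emeasure (\<mu> \<Otimes>\<^sub>M \<mu>) (?X n) = (\<integral>\<^sup>+\<phi>. emeasure \<mu> (Pair \<phi> -` ?X n) \<partial>\<mu>)"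
      by (intro \<mu>.emeasure_pair_measure_alt sets_num_common_edges_ge sets)
    also have "\<dots> \<le> (\<integral>\<^sup>+\<phi>. ennreal ((1 / 2) ^ m) \<partial>\<mu>)"
      by (intro nn_integral_mono slice that)
    also have "\<dots> = ennreal ((1 / 2) ^ m)"
      by (simp add: \<mu>.emeasure_space_1)
    finally show ?thesis unfolding measure_def by (intro enn2real_leI) auto
  qed
  \<comment> \<open>Each further \<open>2 * M\<close> common edges cost a factor 1/2.\<close>
  define \<theta> where "\<theta> = root (2 * M) (1 / 2)"
  have M0: "0 < 2 * M" using M(1) by simp
  have \<theta>: "0 < \<theta>" "\<theta> < 1" "\<theta> ^ (2 * M) = 1 / 2"
    using M0 by (simp_all add: \<theta>_def)
  have "measure (\<mu> \<Otimes>\<^sub>M \<mu>) (?X n) \<le> (1 / \<theta> ^ (2 * M)) * \<theta> ^ n" for n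
  proof -
    \<comment> \<open>For positive \<open>n\<close> this is the largest \<open>m\<close> with
      \<open>2 * (m * M) < n\<close>; for n = 0 truncated subtraction gives
      \<open>m = 0\<close>.\<close>
    define m where "m = (n - 1) div (2 * M)"
    have "2 * (m * M) < n \<or> m = 0"
    proof (cases "n = 0")
      case False
      have "m * (2 * M) \<le> n - 1" unfolding m_def by simp
      then have "2 * (m * M) \<le> n - 1" by (simp add: mult.left_commute)
      with False show ?thesis by linarith
    qed (simp add: m_def)
    then have "measure (\<mu> \<Otimes>\<^sub>M \<mu>) (?X n) \<le> (1 / 2) ^ m" by (rule tail)
    also have "\<dots> = \<theta> ^ (2 * M * m)" by (subst power_mult) (simp only: \<theta>(3))
    \<comment> \<open>The remainder of the division is absorbed into the constant
      \<open>1 / \<theta> ^ (2 * M)\<close>, which equals 2.\<close>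
    also have "\<dots> \<le> \<theta> ^ n / \<theta> ^ (2 * M)"
    proof -
      have "n - 1 < (m + 1) * (2 * M)"
        unfolding m_def using dividend_less_div_times[OF M0, of "n - 1"] by simp
      then have "n \<le> 2 * M * m + 2 * M" by (simp add: algebra_simps)
      then have "\<theta> ^ (2 * M * m + 2 * M) \<le> \<theta> ^ n"
        using \<theta> by (intro power_decreasing) auto
      then show ?thesis using \<theta>(1) by (simp add: pos_le_divide_eq power_add)
    qed
    finally show ?thesis by simp
  qed
  then have "exponential_intersection_tails \<mu>"
    unfolding exponential_intersection_tails_def using \<theta>(1,2) by blast
  with sets \<mu>.prob_space_axioms show ?thesis by blast
qed

end
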